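(* Let $R$ be an arbitrary associative unitary ring, let $L:\mathrm{Mod}(R)\to \mathbb{R}_{\geq 0}\cup\{\infty\}$ be a length function, and let $M_\phi$ be a right $R[X]$-module. Then $$\mathrm{ent}_L(\phi)=\sup\{\mathrm{ent}_L(\phi,F): F\in\mathcal{F}(M)\cap\mathrm{Fin}_L(M)\},$$ where $\mathcal{F}(M)$ is the family of finitely generated $R$-submodules of $M$ and $\mathrm{Fin}_L(M)$ is the family of $R$-submodules of $M$ of finite $L$-length.
   Context: $\mathrm{Mod}(R)$ is the category of right $R$-modules. A function $L:\mathrm{Mod}(R)\to \mathbb{R}_{\geq 0}\cup\{\infty\}$ is a length function if: $L(0)=0$ and $L(M)=L(M')$ whenever $M\cong M'$; $L(M)=L(M')+L(M'')$ for every short exact sequence $0\to M'\to M\to M''\to 0$ (additive); and $L(M)=\sup\{L(F): F \text{ a finitely generated submodule of } M\}$ for all $M$ (upper continuous). A module $N$ has finite $L$-length if $L(N)<\infty$. $M_\phi$, with $M$ a right $R$-module and $\phi\in\mathrm{End}_R(M)$, denotes the right $R[X]$-module with underlying $R$-module $M$ on which $X$ acts as $\phi$. For $N\in\mathrm{Fin}_L(M)$ and $n\geq 1$ let $T_n(\phi,N)=\sum_{i=0}^{n-1}\phi^i(N)$ and $\mathrm{ent}_L(\phi,N)=\lim_{n\to\infty}L(T_n(\phi,N))/n$ (the limit exists and is finite). The algebraic $L$-entropy is $\mathrm{ent}_L(M_\phi)=\mathrm{ent}_L(\phi)=\sup\{\mathrm{ent}_L(\phi,N): N\in\mathrm{Fin}_L(M)\}$.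 *)

theory Defs
  imports
    "HOL.Hull"
    "HOL-Library.Extended_Nonnegative_Real"
    "HOL-Algebra.Module"
    "HOL-Algebra.AbelCoset"
begin

text \<open>
  The locale \<^locale>\<open>module\<close> requires a commutative ring of scalars, so right modules over an
  arbitrary unital ring are introduced here.  The record type and the notion of
  \<^locale>\<open>submodule\<close> are the library ones (these do not depend on commutativity).
  The library writes the scalar on the left: \<open>a \<odot>\<^bsub>M\<^esub> x\<close> stands for \<open>x \<cdot> a\<close>.
  Hence the order of the factors in \<open>smult_assoc\<close>, which reads
  \<open>x \<cdot> (a b) = (x \<cdot> a) \<cdot> b\<close>.
\<close>

locale right_module = R?: ring R + M?: abelian_group M
  for R (structure) and M (structure) +
  assumes smult_closed [simp, intro]:
      "\<lbrakk>a \<in> carrier R; x \<in> carrier M\<rbrakk> \<Longrightarrow> a \<odot>\<^bsub>M\<^esub> x \<in> carrier M"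
    and smult_scalar_distr:
      "\<lbrakk>a \<in> carrier R; b \<in> carrier R; x \<in> carrier M\<rbrakk> \<Longrightarrow>
       (a \<oplus>\<^bsub>R\<^esub> b) \<odot>\<^bsub>M\<^esub> x = a \<odot>\<^bsub>M\<^esub> x \<oplus>\<^bsub>M\<^esub> b \<odot>\<^bsub>M\<^esub> x"
    and smult_vector_distr:
      "\<lbrakk>a \<in> carrier R; x \<in> carrier M; y \<in> carrier M\<rbrakk> \<Longrightarrow>
       a \<odot>\<^bsub>M\<^esub> (x \<oplus>\<^bsub>M\<^esub> y) = a \<odot>\<^bsub>M\<^esub> x \<oplus>\<^bsub>M\<^esub> a \<odot>\<^bsub>M\<^esub> y"
    and smult_assoc:
      "\<lbrakk>a \<in> carrier R; b \<in> carrier R; x \<in> carrier M\<rbrakk> \<Longrightarrow>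
       (a \<otimes>\<^bsub>R\<^esub> b) \<odot>\<^bsub>M\<^esub> x = b \<odot>\<^bsub>M\<^esub> (a \<odot>\<^bsub>M\<^esub> x)"
    and smult_one [simp]:
      "x \<in> carrier M \<Longrightarrow> \<one>\<^bsub>R\<^esub> \<odot>\<^bsub>M\<^esub> x = x"

definition right_module_hom ::
  "('a, 'r) ring_scheme \<Rightarrow> ('a, 'b, 'm) module_scheme \<Rightarrow> ('a, 'c, 'n) module_scheme \<Rightarrow> ('b \<Rightarrow> 'c) set"
  where "right_module_hom R M N =
    {f. f \<in> carrier M \<rightarrow> carrier N \<and>
        (\<forall>x\<in>carrier M. \<forall>y\<in>carrier M. f (x \<oplus>\<^bsub>M\<^esub> y) = f x \<oplus>\<^bsub>N\<^esub> f y) \<and>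
        (\<forall>a\<in>carrier R. \<forall>x\<in>carrier M. f (a \<odot>\<^bsub>M\<^esub> x) = a \<odot>\<^bsub>N\<^esub> f x)}"

definition right_module_isomorphic ::
  "('a, 'r) ring_scheme \<Rightarrow> ('a, 'b, 'm) module_scheme \<Rightarrow> ('a, 'c, 'n) module_scheme \<Rightarrow> bool"
  where "right_module_isomorphic R M N \<longleftrightarrow>
    (\<exists>f\<in>right_module_hom R M N. bij_betw f (carrier M) (carrier N))"

definition short_exact ::
  "('a, 'r) ring_scheme \<Rightarrow> ('a, 'b, 'm) module_scheme \<Rightarrow> ('b \<Rightarrow> 'c) \<Rightarrow>
   ('a, 'c, 'n) module_scheme \<Rightarrow> ('c \<Rightarrow> 'd) \<Rightarrow> ('a, 'd, 'k) module_scheme \<Rightarrow> bool"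
  where "short_exact R M' f M g M'' \<longleftrightarrow>
    f \<in> right_module_hom R M' M \<and> g \<in> right_module_hom R M M'' \<and>
    inj_on f (carrier M') \<and>
    f ` carrier M' = a_kernel M M'' g \<and>
    g ` carrier M = carrier M''"

definition fin_gen_submodules ::
  "('a, 'r) ring_scheme \<Rightarrow> ('a, 'b, 'm) module_scheme \<Rightarrow> 'b set set"
  where "fin_gen_submodules R M =
    {(\<lambda>N. submodule N R M) hull A |A. finite A \<and> A \<subseteq> carrier M}"

text \<open>
  The class of all right \<open>R\<close>-modules is not available as a type.  It is rendered by all right
  \<open>R\<close>-modules whose carrier is a set of elements of a type \<open>'b\<close>, with \<open>'b\<close> arbitrary.  This
  class is closed under submodules and (via representatives) under quotients, and every length
  function on the whole category restricts to one in the sense below.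
\<close>

locale length_function =
  fixes R :: "('a, 'r) ring_scheme" and L :: "('a, 'b) module \<Rightarrow> ennreal"
  assumes zero: "\<lbrakk>right_module R M; carrier M = {\<zero>\<^bsub>M\<^esub>}\<rbrakk> \<Longrightarrow> L M = 0"
    and isomorphic:
      "\<lbrakk>right_module R M; right_module R M'; right_module_isomorphic R M M'\<rbrakk> \<Longrightarrow> L M = L M'"
    and additive:
      "\<lbrakk>right_module R M'; right_module R M; right_module R M''; short_exact R M' f M g M''\<rbrakk>
       \<Longrightarrow> L M = L M' + L M''"
    and upper_continuous:
      "right_module R M \<Longrightarrow> L M = (SUP F\<in>fin_gen_submodules R M. L (M\<lparr>carrier := F\<rparr>))"

definition finite_length_submodules ::
  "('a, 'r) ring_scheme \<Rightarrow> (('a, 'b) module \<Rightarrow> ennreal) \<Rightarrow> ('a, 'b) module \<Rightarrow> 'b set set"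
  where "finite_length_submodules R L M =
    {N. submodule N R M \<and> L (M\<lparr>carrier := N\<rparr>) < \<infinity>}"

text \<open>\<open>trajectory M \<phi> N n\<close> is \<open>N + \<phi> N + \<dots> + \<phi>\<^sup>n\<^sup>-\<^sup>1 N\<close>; the case \<open>n = 0\<close> is the empty sum.\<close>

primrec trajectory ::
  "('a, 'b, 'm) module_scheme \<Rightarrow> ('b \<Rightarrow> 'b) \<Rightarrow> 'b set \<Rightarrow> nat \<Rightarrow> 'b set"
  where
    "trajectory M \<phi> N 0 = {\<zero>\<^bsub>M\<^esub>}"
  | "trajectory M \<phi> N (Suc n) = trajectory M \<phi> N n <+>\<^bsub>M\<^esub> (\<phi> ^^ n) ` N"

definition entropy_at ::
  "(('a, 'b) module \<Rightarrow> ennreal) \<Rightarrow> ('a, 'b) module \<Rightarrow> ('b \<Rightarrow> 'b) \<Rightarrow> 'b set \<Rightarrow> ennreal"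
  where "entropy_at L M \<phi> N =
    lim (\<lambda>n. L (M\<lparr>carrier := trajectory M \<phi> N n\<rparr>) / of_nat n)"

text \<open>
  A right \<open>R[X]\<close>-module is given by a right \<open>R\<close>-module \<open>M\<close> together with an \<open>R\<close>-endomorphism
  \<open>\<phi>\<close> of \<open>M\<close>, the action of \<open>X\<close>; its entropy is that of the pair.
\<close>

definition entropy ::
  "('a, 'r) ring_scheme \<Rightarrow> (('a, 'b) module \<Rightarrow> ennreal) \<Rightarrow> ('a, 'b) module \<Rightarrow> ('b \<Rightarrow> 'b) \<Rightarrow> ennreal"
  where "entropy R L M \<phi> = (SUP N\<in>finite_length_submodules R L M. entropy_at L M \<phi> N)"

end

theory Submission
  imports Defs
begin

text \<open>
  A submodule \<open>N\<close> of finite length contains, by upper continuity, a finitely generated \<open>F\<close> with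
  \<open>L N \<le> L F + \<epsilon>\<close>.  Passing from \<open>N\<close> to \<open>F\<close> then costs at most \<open>\<epsilon>\<close> in each of the \<open>n\<close>
  summands of the trajectory, so \<open>L (T\<^sub>n N) \<le> L (T\<^sub>n F) + n \<epsilon>\<close> and the two entropies differ by at
  most \<open>\<epsilon>\<close>.
\<close>

section \<open>Subadditive sequences\<close>

text \<open>With \<open>q = n div m\<close> and \<open>r = n mod m\<close> this is the division with
  remainder behind Fekete's lemma. With \<open>m = 1\<close> and \<open>r = 0\<close> it bounds the
  remainder linearly.\<close>

lemma subadditive_multiple:
  fixes a :: "nat \<Rightarrow> real"
  assumes sub: "\<And>m n. a (m + n) \<le> a m + a n"
  shows "a (q * m + r) \<le> real q * a m + a r"
proof (induction q)
  case (Suc q)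
  have "a (Suc q * m + r) \<le> a m + a (q * m + r)"
    using sub[of m "q * m + r"] by (simp add: add.assoc)
  with Suc show ?case by (simp add: algebra_simps)
qed simp

text \<open>The limit is the infimum \<open>l\<close> of the quotients over \<open>n >= 1\<close>,
  which exists because they are nonnegative. If some quotient at \<open>m\<close> lies below
  \<open>x\<close>, division of \<open>n\<close> by \<open>m\<close> forces all late quotients below
  \<open>x\<close>.\<close>

lemma fekete:
  fixes a :: "nat \<Rightarrow> real"
  assumes nonneg: "\<And>n. 0 \<le> a n" and sub: "\<And>m n. a (m + n) \<le> a m + a n"
  shows "convergent (\<lambda>n. a n / real n)"
proof -
  define l where "l = (INF n\<in>{1..}. a n / real n)"
  have bdd: "bdd_below ((\<lambda>n. a n / real n) ` {1..})"
    by (rule bdd_belowI[of _ 0]) (auto simp: nonneg)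
  have "(\<lambda>n. a n / real n) \<longlonglongrightarrow> l"
  proof (rule order_tendstoI)
    fix x assume "x < l"
    then show "\<forall>\<^sub>F n in sequentially. x < a n / real n"
      using cINF_lower[OF bdd]
      by (intro eventually_sequentiallyI[of 1]) (force simp: l_def)
  next
    fix x assume "l < x"
    then obtain m where m: "m \<ge> 1" "a m / real m < x"
      unfolding l_def using cINF_less_iff[OF _ bdd] by auto
    \<comment> \<open>The remainder contributes at most \<open>real m * a 1 + a 0\<close>, which
      does not depend on \<open>n\<close> and so vanishes after division by \<open>n\<close>. The
      term \<open>a 0\<close> stays because subadditivity only makes it nonnegative, not
      zero.\<close>
    have bound: "a n / real n \<le> a m / real m + (real m * a 1 + a 0) / real n" if "n \<ge> 1" for n
    proof -
      have "a n \<le> real (n div m) * a m + a (n mod m)"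
        using subadditive_multiple[of a "n div m" m "n mod m", OF sub] by simp
      also have "a (n mod m) \<le> real (n mod m) * a 1 + a 0"
        using subadditive_multiple[of a "n mod m" 1 0, OF sub] by simp
      also have "real (n mod m) * a 1 \<le> real m * a 1"
        using m nonneg by (intro mult_right_mono) auto
      also have "real (n div m) * a m \<le> real n / real m * a m"
        using of_nat_div_le_of_nat nonneg by (intro mult_right_mono) auto
      finally have "a n \<le> real n / real m * a m + (real m * a 1 + a 0)" by simp
      then have "a n / real n \<le> (real n / real m * a m + (real m * a 1 + a 0)) / real n"
        by (rule divide_right_mono) simp
      also have "\<dots> = a m / real m + (real m * a 1 + a 0) / real n"
        using that by (simp add: add_divide_distrib)
      finally show ?thesis .
    qed
    have "(\<lambda>n. a m / real m + (real m * a 1 + a 0) / real n) \<longlonglongrightarrow> a m / real m + 0"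
      by (intro tendsto_add tendsto_const lim_const_over_n)
    with m have "\<forall>\<^sub>F n in sequentially. a m / real m + (real m * a 1 + a 0) / real n < x"
      by (intro order_tendstoD) auto
    then show "\<forall>\<^sub>F n in sequentially. a n / real n < x"
      using eventually_ge_at_top[of 1] by eventually_elim (use bound in fastforce)
  qed
  then show ?thesis by (rule convergentI)
qed

lemma fekete_ennreal:
  fixes c :: "nat \<Rightarrow> ennreal"
  assumes fin: "\<And>n. c n < \<infinity>" and sub: "\<And>m n. c (m + n) \<le> c m + c n"
  shows "convergent (\<lambda>n. c n / of_nat n)"
proof -
  define a where "a n = enn2real (c n)" for n
  have c: "c n = ennreal (a n)" for n using fin[of n] by (simp add: a_def)
  have a0: "0 \<le> a n" for n by (simp add: a_def)
  have "a (m + n) \<le> a m + a n" for m n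
    using sub[of m n] a0 by (simp add: c flip: ennreal_plus)
  then obtain l where "(\<lambda>n. a n / real n) \<longlonglongrightarrow> l"
    using fekete[of a] a0 by (auto simp: convergent_def)
  then have "(\<lambda>n. ennreal (a n / real n)) \<longlonglongrightarrow> ennreal l" by (rule tendsto_ennrealI)
  \<comment> \<open>The two quotients may differ at \<open>n = 0\<close>, since division by zero
    gives 0 over the reals but multiplies by infinity in \<open>ennreal\<close>. Hence the equality
    is only claimed eventually.\<close>
  moreover have "\<forall>\<^sub>F n in sequentially. ennreal (a n / real n) = c n / of_nat n"
    using eventually_gt_at_top[of 0]
    by eventually_elim (simp add: c a0 divide_ennreal ennreal_of_nat_eq_real_of_nat)
  ultimately have "(\<lambda>n. c n / of_nat n) \<longlonglongrightarrow> ennreal l" by (rule Lim_transform_eventually)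
  then show ?thesis by (rule convergentI)
qed

section \<open>Submodules and homomorphisms\<close>

context right_module
begin

lemma zero_smult [simp]:
  assumes "x \<in> carrier M"
  shows "\<zero>\<^bsub>R\<^esub> \<odot>\<^bsub>M\<^esub> x = \<zero>\<^bsub>M\<^esub>"
  using smult_scalar_distr[of "\<zero>\<^bsub>R\<^esub>" "\<zero>\<^bsub>R\<^esub>" x] assms by (simp add: M.add.l_cancel_one')

lemma smult_zero [simp]:
  assumes "a \<in> carrier R"
  shows "a \<odot>\<^bsub>M\<^esub> \<zero>\<^bsub>M\<^esub> = \<zero>\<^bsub>M\<^esub>"
  using smult_vector_distr[of a "\<zero>\<^bsub>M\<^esub>" "\<zero>\<^bsub>M\<^esub>"] assms by (simp add: M.add.l_cancel_one')

lemma minus_one_smult: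
  assumes "x \<in> carrier M"
  shows "(\<ominus>\<^bsub>R\<^esub> \<one>\<^bsub>R\<^esub>) \<odot>\<^bsub>M\<^esub> x = \<ominus>\<^bsub>M\<^esub> x"
  using smult_scalar_distr[of "\<ominus>\<^bsub>R\<^esub> \<one>\<^bsub>R\<^esub>" "\<one>\<^bsub>R\<^esub>" x] assms
  by (simp add: M.minus_equality R.l_neg)

lemma smult_minus:
  assumes "a \<in> carrier R" "x \<in> carrier M"
  shows "a \<odot>\<^bsub>M\<^esub> (\<ominus>\<^bsub>M\<^esub> x) = \<ominus>\<^bsub>M\<^esub> (a \<odot>\<^bsub>M\<^esub> x)"
  using smult_vector_distr[of a "\<ominus>\<^bsub>M\<^esub> x" x] assms
  by (simp add: M.minus_equality M.l_neg)

text \<open>Closure under additive inverses comes for free: the inverse of \<open>x\<close> is the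
  action of the scalar -1 on \<open>x\<close>.\<close>

lemma submodule_iff:
  "submodule H R M \<longleftrightarrow> H \<subseteq> carrier M \<and> \<zero>\<^bsub>M\<^esub> \<in> H \<and>
     (\<forall>x\<in>H. \<forall>y\<in>H. x \<oplus>\<^bsub>M\<^esub> y \<in> H) \<and> (\<forall>a\<in>carrier R. \<forall>x\<in>H. a \<odot>\<^bsub>M\<^esub> x \<in> H)"
  (is "_ \<longleftrightarrow> ?rhs")
proof
  assume "submodule H R M"
  then interpret H: submodule H R M .
  show ?rhs
    using H.subset H.m_closed H.one_closed by auto
next
  assume H: ?rhs
  have "\<ominus>\<^bsub>M\<^esub> x \<in> H" if "x \<in> H" for x
    using H that minus_one_smult[of x] by (metis R.add.inv_closed R.one_closed subsetD)
  with H show "submodule H R M"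
    by unfold_locales (auto simp: a_inv_def)
qed

lemma submodule_subset: "submodule H R M \<Longrightarrow> H \<subseteq> carrier M"
  by (simp add: submodule_iff)

lemma submodule_minus:
  assumes "submodule H R M" "x \<in> H"
  shows "\<ominus>\<^bsub>M\<^esub> x \<in> H"
  using subgroup.m_inv_closed[OF submodule.axioms(1)] assms by (auto simp: a_inv_def)

lemma right_module_restrict:
  assumes "submodule H R M"
  shows "right_module R (M\<lparr>carrier := H\<rparr>)"
proof -
  note H = assms[unfolded submodule_iff]
  then have mem: "\<And>x. x \<in> H \<Longrightarrow> x \<in> carrier M" by auto
  have "abelian_group (M\<lparr>carrier := H\<rparr>)"
  proof (rule abelian_groupI)
    fix x assume "x \<in> carrier (M\<lparr>carrier := H\<rparr>)"
    then show "\<exists>y\<in>carrier (M\<lparr>carrier := H\<rparr>). y \<oplus>\<^bsub>M\<lparr>carrier := H\<rparr>\<^esub> x = \<zero>\<^bsub>M\<lparr>carrier := H\<rparr>\<^esub>"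
      using submodule_minus[OF assms, of x] mem by (auto intro!: bexI[of _ "\<ominus>\<^bsub>M\<^esub> x"] simp: M.l_neg)
  qed (use H mem M.a_assoc M.a_comm in auto)
  then show ?thesis
    using H mem R.ring_axioms
    by (intro right_module.intro right_module_axioms.intro)
      (auto simp: smult_scalar_distr smult_vector_distr smult_assoc)
qed

section \<open>Submodules of a submodule, and generation\<close>

lemma submodule_restrict_iff:
  assumes "submodule N R M"
  shows "submodule H R (M\<lparr>carrier := N\<rparr>) \<longleftrightarrow> submodule H R M \<and> H \<subseteq> N"
proof -
  interpret N: right_module R "M\<lparr>carrier := N\<rparr>" by (rule right_module_restrict[OF assms])
  show ?thesis
    using assms unfolding N.submodule_iff submodule_iff by auto
qed

lemma submodule_hull:
  assumes "A \<subseteq> carrier M"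
  shows "submodule ((\<lambda>N. submodule N R M) hull A) R M"
proof -
  \<comment> \<open>The whole carrier is one of the submodules being intersected, so the hull stays
    inside it.\<close>
  have "submodule (carrier M) R M" by (auto simp: submodule_iff)
  with assms show ?thesis
    unfolding hull_def submodule_iff by (auto simp: subset_iff)
qed

text \<open>Upper continuity, applied to \<open>N\<close> as a module, yields submodules generated
  inside \<open>N\<close>. Generation inside \<open>M\<close> gives the same result, because
  \<open>N\<close> itself is a submodule of \<open>M\<close> containing the generators.\<close>

lemma fin_gen_submodules_restrict:
  assumes N: "submodule N R M" and F: "F \<in> fin_gen_submodules R (M\<lparr>carrier := N\<rparr>)"
  shows "F \<in> fin_gen_submodules R M" and "submodule F R M" and "F \<subseteq> N"
proof -
  obtain A where A: "finite A" "A \<subseteq> N"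
    and F_eq: "F = (\<lambda>H. submodule H R (M\<lparr>carrier := N\<rparr>)) hull A"
    using F by (auto simp: fin_gen_submodules_def)
  have NM: "N \<subseteq> carrier M" using N by (rule submodule_subset)
  have sub: "submodule ((\<lambda>H. submodule H R M) hull A) R M"
    using A NM by (intro submodule_hull) auto
  have le: "(\<lambda>H. submodule H R M) hull A \<subseteq> N"
    using A N by (intro hull_minimal)
  have eq: "F = (\<lambda>H. submodule H R M) hull A"
    unfolding F_eq
  proof (rule hull_unique)
    show "A \<subseteq> (\<lambda>H. submodule H R M) hull A" by (rule hull_subset)
    show "submodule ((\<lambda>H. submodule H R M) hull A) R (M\<lparr>carrier := N\<rparr>)"
      using sub le by (simp add: submodule_restrict_iff[OF N])
    show "(\<lambda>H. submodule H R M) hull A \<subseteq> B"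
      if "A \<subseteq> B" "submodule B R (M\<lparr>carrier := N\<rparr>)" for B
      using that by (intro hull_minimal) (auto simp: submodule_restrict_iff[OF N])
  qed
  show "F \<in> fin_gen_submodules R M" using A NM eq by (auto simp: fin_gen_submodules_def)
  show "submodule F R M" "F \<subseteq> N" using sub le eq by auto
qed

lemma submodule_zero: "submodule {\<zero>\<^bsub>M\<^esub>} R M"
  by (auto simp: submodule_iff)

lemma submodule_Int:
  "submodule A R M \<Longrightarrow> submodule B R M \<Longrightarrow> submodule (A \<inter> B) R M"
  by (auto simp: submodule_iff)

section \<open>Sums of submodules\<close>

lemma submodule_set_add:
  assumes "submodule A R M" "submodule B R M"
  shows "submodule (A <+>\<^bsub>M\<^esub> B) R M"
proof -
  note A = assms(1)[unfolded submodule_iff] and B = assms(2)[unfolded submodule_iff]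
  have "\<exists>u\<in>A. \<exists>v\<in>B. (a \<oplus>\<^bsub>M\<^esub> b) \<oplus>\<^bsub>M\<^esub> (a' \<oplus>\<^bsub>M\<^esub> b') = u \<oplus>\<^bsub>M\<^esub> v"
    if "a \<in> A" "b \<in> B" "a' \<in> A" "b' \<in> B" for a b a' b'
    using that A B
    by (intro bexI[of _ "a \<oplus>\<^bsub>M\<^esub> a'"] bexI[of _ "b \<oplus>\<^bsub>M\<^esub> b'"]) (auto simp: M.a_ac subset_iff)
  moreover have "\<exists>u\<in>A. \<exists>v\<in>B. r \<odot>\<^bsub>M\<^esub> (a \<oplus>\<^bsub>M\<^esub> b) = u \<oplus>\<^bsub>M\<^esub> v"
    if "a \<in> A" "b \<in> B" "r \<in> carrier R" for a b r
    using that A B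
    by (intro bexI[of _ "r \<odot>\<^bsub>M\<^esub> a"] bexI[of _ "r \<odot>\<^bsub>M\<^esub> b"]) (auto simp: smult_vector_distr subset_iff)
  moreover have "\<exists>u\<in>A. \<exists>v\<in>B. \<zero>\<^bsub>M\<^esub> = u \<oplus>\<^bsub>M\<^esub> v"
    using A B by (intro bexI[of _ "\<zero>\<^bsub>M\<^esub>"]) auto
  ultimately show ?thesis
    using A B unfolding submodule_iff by (auto simp: set_add_def')
qed

lemma set_add_upper:
  assumes "submodule A R M" "submodule B R M"
  shows "A \<subseteq> A <+>\<^bsub>M\<^esub> B" and "B \<subseteq> A <+>\<^bsub>M\<^esub> B"
proof -
  note A = assms(1)[unfolded submodule_iff] and B = assms(2)[unfolded submodule_iff]
  have "\<exists>h\<in>A. \<exists>k\<in>B. x = h \<oplus>\<^bsub>M\<^esub> k" if "x \<in> A" for x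
    using that A B by (intro bexI[of _ x] bexI[of _ "\<zero>\<^bsub>M\<^esub>" B]) auto
  then show "A \<subseteq> A <+>\<^bsub>M\<^esub> B" by (auto simp: set_add_def')
  have "\<exists>h\<in>A. \<exists>k\<in>B. x = h \<oplus>\<^bsub>M\<^esub> k" if "x \<in> B" for x
    using that A B by (intro bexI[of _ "\<zero>\<^bsub>M\<^esub>" A] bexI[of _ x]) auto
  then show "B \<subseteq> A <+>\<^bsub>M\<^esub> B" by (auto simp: set_add_def')
qed

lemma set_add_assoc:
  assumes "A \<subseteq> carrier M" "B \<subseteq> carrier M" "C \<subseteq> carrier M"
  shows "(A <+>\<^bsub>M\<^esub> B) <+>\<^bsub>M\<^esub> C = A <+>\<^bsub>M\<^esub> (B <+>\<^bsub>M\<^esub> C)"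
  using M.add.set_mult_assoc[OF assms] by (simp add: set_add_def)

lemma set_add_comm:
  assumes "A \<subseteq> carrier M" "B \<subseteq> carrier M"
  shows "A <+>\<^bsub>M\<^esub> B = B <+>\<^bsub>M\<^esub> A"
  using assms unfolding set_add_def' by (auto simp: subset_iff) (metis M.a_comm)+

lemma set_add_absorb:
  assumes "submodule A R M" "submodule B R M" "B \<subseteq> A"
  shows "A <+>\<^bsub>M\<^esub> B = A"
proof
  show "A <+>\<^bsub>M\<^esub> B \<subseteq> A" using assms unfolding submodule_iff set_add_def' by auto
qed (rule set_add_upper[OF assms(1,2)])

end

lemma set_add_mono: "A \<subseteq> A' \<Longrightarrow> B \<subseteq> B' \<Longrightarrow> A <+>\<^bsub>M\<^esub> B \<subseteq> A' <+>\<^bsub>M\<^esub> B'"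
  unfolding set_add_def' by blast

section \<open>Homomorphisms, images and kernels\<close>

lemma right_module_homD:
  assumes "f \<in> right_module_hom R M N"
  shows "x \<in> carrier M \<Longrightarrow> f x \<in> carrier N"
    and "x \<in> carrier M \<Longrightarrow> y \<in> carrier M \<Longrightarrow> f (x \<oplus>\<^bsub>M\<^esub> y) = f x \<oplus>\<^bsub>N\<^esub> f y"
    and "a \<in> carrier R \<Longrightarrow> x \<in> carrier M \<Longrightarrow> f (a \<odot>\<^bsub>M\<^esub> x) = a \<odot>\<^bsub>N\<^esub> f x"
  using assms by (auto simp: right_module_hom_def)

lemma right_module_hom_zero:
  assumes "right_module R M" "right_module R N" "f \<in> right_module_hom R M N"
  shows "f \<zero>\<^bsub>M\<^esub> = \<zero>\<^bsub>N\<^esub>"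
proof -
  interpret M: right_module R M by fact
  interpret N: right_module R N by fact
  show ?thesis
    \<comment> \<open>Zero is written as the zero scalar acting on zero; compatibility with scalars
      then turns its image into the zero scalar acting on something.\<close>
    using right_module_homD(3)[OF assms(3) M.R.zero_closed M.M.zero_closed]
      right_module_homD(1)[OF assms(3) M.M.zero_closed]
    by simp
qed

lemma submodule_image:
  assumes "right_module R M" "right_module R N" "f \<in> right_module_hom R M N" "submodule A R M"
  shows "submodule (f ` A) R N"
proof -
  interpret M: right_module R M by fact
  interpret N: right_module R N by fact
  note A = assms(4)[unfolded M.submodule_iff]
  have "\<zero>\<^bsub>N\<^esub> \<in> f ` A" using A right_module_hom_zero[OF assms(1-3)] by force
  moreover have "f x \<oplus>\<^bsub>N\<^esub> f y \<in> f ` A" if "x \<in> A" "y \<in> A" for x y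
    using that A right_module_homD(2)[OF assms(3), of x y]
    by (intro image_eqI[of _ f "x \<oplus>\<^bsub>M\<^esub> y"]) (auto simp: subset_iff)
  moreover have "a \<odot>\<^bsub>N\<^esub> f x \<in> f ` A" if "x \<in> A" "a \<in> carrier R" for x a
    using that A right_module_homD(3)[OF assms(3), of a x]
    by (intro image_eqI[of _ f "a \<odot>\<^bsub>M\<^esub> x"]) (auto simp: subset_iff)
  ultimately show ?thesis
    using A assms(3) unfolding N.submodule_iff by (auto simp: right_module_hom_def)
qed

lemma submodule_a_kernel:
  assumes "right_module R M" "right_module R N" "f \<in> right_module_hom R M N"
  shows "submodule (a_kernel M N f) R M"
proof -
  interpret M: right_module R M by fact
  interpret N: right_module R N by fact
  show ?thesis
    unfolding M.submodule_iff a_kernel_def'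
    using assms(3) right_module_hom_zero[OF assms] by (auto simp: right_module_hom_def)
qed

lemma image_set_add:
  assumes "f \<in> right_module_hom R M N" "A \<subseteq> carrier M" "B \<subseteq> carrier M"
  shows "f ` (A <+>\<^bsub>M\<^esub> B) = f ` A <+>\<^bsub>N\<^esub> f ` B"
proof -
  have add: "f (a \<oplus>\<^bsub>M\<^esub> b) = f a \<oplus>\<^bsub>N\<^esub> f b" if "a \<in> A" "b \<in> B" for a b
    using that assms by (auto simp: right_module_hom_def subset_iff)
  show ?thesis
  proof
    show "f ` (A <+>\<^bsub>M\<^esub> B) \<subseteq> f ` A <+>\<^bsub>N\<^esub> f ` B"
      unfolding set_add_def' using add by fastforce
    show "f ` A <+>\<^bsub>N\<^esub> f ` B \<subseteq> f ` (A <+>\<^bsub>M\<^esub> B)"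
    proof
      fix z assume "z \<in> f ` A <+>\<^bsub>N\<^esub> f ` B"
      then obtain a b where "a \<in> A" "b \<in> B" "z = f a \<oplus>\<^bsub>N\<^esub> f b"
        unfolding set_add_def' by auto
      then show "z \<in> f ` (A <+>\<^bsub>M\<^esub> B)"
        using add[of a b] by (intro image_eqI[of _ f "a \<oplus>\<^bsub>M\<^esub> b"]) (auto simp: set_add_def')
    qed
  qed
qed

lemma right_module_hom_funpow:
  assumes "f \<in> right_module_hom R M M"
  shows "f ^^ n \<in> right_module_hom R M M"
proof (induction n)
  case (Suc n)
  with assms show ?case unfolding right_module_hom_def by (auto simp: Pi_iff)
qed (simp add: right_module_hom_def)

text \<open>All module axioms are equations or existence statements, so they pass along a surjection
  compatible with the operations, without knowing beforehand that \<open>Q\<close> is a group. This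
  equips the quotient with its module structure.\<close>

lemma right_module_surj_image:
  assumes "right_module R M" and surj: "f ` carrier M = carrier Q"
    and add: "\<And>x y. x \<in> carrier M \<Longrightarrow> y \<in> carrier M \<Longrightarrow> f x \<oplus>\<^bsub>Q\<^esub> f y = f (x \<oplus>\<^bsub>M\<^esub> y)"
    and smult: "\<And>a x. a \<in> carrier R \<Longrightarrow> x \<in> carrier M \<Longrightarrow> a \<odot>\<^bsub>Q\<^esub> f x = f (a \<odot>\<^bsub>M\<^esub> x)"
    and zero: "\<zero>\<^bsub>Q\<^esub> = f \<zero>\<^bsub>M\<^esub>"
  shows "right_module R Q"
proof -
  interpret M: right_module R M by fact
  have closed: "f x \<in> carrier Q" if "x \<in> carrier M" for x using that surj by auto
  have carrierE: thesis if "y \<in> carrier Q" "\<And>x. x \<in> carrier M \<Longrightarrow> y = f x \<Longrightarrow> thesis" for y thesis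
    using that surj by auto
  have Q: "abelian_group Q"
  proof (rule abelian_groupI)
    fix x assume "x \<in> carrier Q"
    then obtain u where u: "u \<in> carrier M" "x = f u" by (rule carrierE)
    then show "\<exists>y\<in>carrier Q. y \<oplus>\<^bsub>Q\<^esub> x = \<zero>\<^bsub>Q\<^esub>"
      by (intro bexI[of _ "f (\<ominus>\<^bsub>M\<^esub> u)"]) (auto simp: add zero closed M.l_neg)
  qed (auto elim!: carrierE simp: add zero closed M.a_ac)
  show ?thesis
    by (intro right_module.intro right_module_axioms.intro M.R.ring_axioms Q)
      (elim carrierE, simp add: add smult closed M.smult_scalar_distr M.smult_vector_distr M.smult_assoc)+
qed

section \<open>Quotients\<close>

text \<open>
  A length function is only defined on modules with elements in \<open>'b\<close>, so the quotient \<open>M / A\<close> has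
  chosen coset representatives as elements rather than cosets.
\<close>

definition coset_rep :: "('a, 'b, 'm) module_scheme \<Rightarrow> 'b set \<Rightarrow> 'b \<Rightarrow> 'b"
  where "coset_rep M A x = (SOME y. y \<in> carrier M \<and> x \<ominus>\<^bsub>M\<^esub> y \<in> A)"

definition quotient_module ::
  "('a, 'b, 'm) module_scheme \<Rightarrow> 'b set \<Rightarrow> ('a, 'b, 'm) module_scheme"
  where "quotient_module M A =
    M\<lparr>carrier := coset_rep M A ` carrier M,
      zero := coset_rep M A \<zero>\<^bsub>M\<^esub>,
      add := \<lambda>x y. coset_rep M A (x \<oplus>\<^bsub>M\<^esub> y),
      smult := \<lambda>a x. coset_rep M A (a \<odot>\<^bsub>M\<^esub> x)\<rparr>"

context right_module
begin

context
  fixes A assumes A: "submodule A R M"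
begin

lemma coset_sym:
  assumes "x \<in> carrier M" "y \<in> carrier M" "x \<ominus>\<^bsub>M\<^esub> y \<in> A"
  shows "y \<ominus>\<^bsub>M\<^esub> x \<in> A"
  using submodule_minus[OF A assms(3)] assms(1,2)
  by (simp add: M.minus_eq M.minus_add M.a_comm)

lemma coset_trans:
  assumes "x \<in> carrier M" "y \<in> carrier M" "z \<in> carrier M" "x \<ominus>\<^bsub>M\<^esub> y \<in> A" "y \<ominus>\<^bsub>M\<^esub> z \<in> A"
  shows "x \<ominus>\<^bsub>M\<^esub> z \<in> A"
proof -
  have "(x \<ominus>\<^bsub>M\<^esub> y) \<oplus>\<^bsub>M\<^esub> (y \<ominus>\<^bsub>M\<^esub> z) = x \<ominus>\<^bsub>M\<^esub> z"
    using assms(1-3) by (simp add: M.minus_eq M.a_assoc M.r_neg1)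
  then show ?thesis using A assms(4,5) by (metis submodule_iff)
qed

lemma coset_rep:
  assumes "x \<in> carrier M"
  shows "coset_rep M A x \<in> carrier M" and "x \<ominus>\<^bsub>M\<^esub> coset_rep M A x \<in> A"
proof -
  have "x \<in> carrier M \<and> x \<ominus>\<^bsub>M\<^esub> x \<in> A"
    using assms A by (simp add: M.minus_eq M.r_neg submodule_iff)
  from someI[of "\<lambda>y. y \<in> carrier M \<and> x \<ominus>\<^bsub>M\<^esub> y \<in> A", OF this]
  show "coset_rep M A x \<in> carrier M" "x \<ominus>\<^bsub>M\<^esub> coset_rep M A x \<in> A"
    by (auto simp: coset_rep_def)
qed

text \<open>Congruent elements satisfy the same predicate under \<open>SOME\<close>, so the choice
  depends only on the coset.\<close>

lemma coset_rep_eq_iff: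
  assumes "x \<in> carrier M" "y \<in> carrier M"
  shows "coset_rep M A x = coset_rep M A y \<longleftrightarrow> x \<ominus>\<^bsub>M\<^esub> y \<in> A"
proof
  assume "coset_rep M A x = coset_rep M A y"
  then show "x \<ominus>\<^bsub>M\<^esub> y \<in> A"
    using assms coset_rep coset_sym coset_trans by metis
next
  assume "x \<ominus>\<^bsub>M\<^esub> y \<in> A"
  then have "(\<lambda>z. z \<in> carrier M \<and> x \<ominus>\<^bsub>M\<^esub> z \<in> A) = (\<lambda>z. z \<in> carrier M \<and> y \<ominus>\<^bsub>M\<^esub> z \<in> A)"
    using assms coset_sym coset_trans by blast
  then show "coset_rep M A x = coset_rep M A y" by (simp add: coset_rep_def)
qed

text \<open>Addition is well defined on cosets: the difference of the two sums is the sum of the two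
  differences, both in \<open>A\<close>.\<close>

lemma coset_rep_add:
  assumes "x \<in> carrier M" "y \<in> carrier M"
  shows "coset_rep M A (coset_rep M A x \<oplus>\<^bsub>M\<^esub> coset_rep M A y) = coset_rep M A (x \<oplus>\<^bsub>M\<^esub> y)"
proof -
  define x' y' where "x' = coset_rep M A x" and "y' = coset_rep M A y"
  have mem: "x' \<in> carrier M" "y' \<in> carrier M" "x \<ominus>\<^bsub>M\<^esub> x' \<in> A" "y \<ominus>\<^bsub>M\<^esub> y' \<in> A"
    using assms coset_rep by (auto simp: x'_def y'_def)
  have "(x \<oplus>\<^bsub>M\<^esub> y) \<ominus>\<^bsub>M\<^esub> (x' \<oplus>\<^bsub>M\<^esub> y') = (x \<ominus>\<^bsub>M\<^esub> x') \<oplus>\<^bsub>M\<^esub> (y \<ominus>\<^bsub>M\<^esub> y')"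
    using assms mem by (simp add: M.minus_eq M.minus_add M.a_ac)
  with mem(3,4) A have "(x \<oplus>\<^bsub>M\<^esub> y) \<ominus>\<^bsub>M\<^esub> (x' \<oplus>\<^bsub>M\<^esub> y') \<in> A" by (simp add: submodule_iff)
  then show ?thesis
    using assms mem by (simp add: coset_rep_eq_iff flip: x'_def y'_def) (metis M.a_closed coset_sym)
qed

lemma coset_rep_smult:
  assumes "a \<in> carrier R" "x \<in> carrier M"
  shows "coset_rep M A (a \<odot>\<^bsub>M\<^esub> coset_rep M A x) = coset_rep M A (a \<odot>\<^bsub>M\<^esub> x)"
proof -
  define x' where "x' = coset_rep M A x"
  have mem: "x' \<in> carrier M" "x \<ominus>\<^bsub>M\<^esub> x' \<in> A"
    using assms coset_rep by (auto simp: x'_def)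
  have "(a \<odot>\<^bsub>M\<^esub> x) \<ominus>\<^bsub>M\<^esub> (a \<odot>\<^bsub>M\<^esub> x') = a \<odot>\<^bsub>M\<^esub> (x \<ominus>\<^bsub>M\<^esub> x')"
    using assms mem by (simp add: M.minus_eq smult_vector_distr smult_minus)
  with mem(2) A assms have "(a \<odot>\<^bsub>M\<^esub> x) \<ominus>\<^bsub>M\<^esub> (a \<odot>\<^bsub>M\<^esub> x') \<in> A" by (simp add: submodule_iff)
  then show ?thesis
    using assms mem by (simp add: coset_rep_eq_iff flip: x'_def) (metis smult_closed coset_sym)
qed

lemma right_module_quotient: "right_module R (quotient_module M A)"
  by (rule right_module_surj_image[OF right_module_axioms, where f = "coset_rep M A"])
    (auto simp: quotient_module_def coset_rep_add coset_rep_smult)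

lemma coset_rep_hom: "coset_rep M A \<in> right_module_hom R M (quotient_module M A)"
  by (auto simp: right_module_hom_def quotient_module_def coset_rep_add coset_rep_smult)

lemma a_kernel_coset_rep: "a_kernel M (quotient_module M A) (coset_rep M A) = A"
proof -
  \<comment> \<open>The zero of the quotient is the representative chosen for zero, which need not
    be zero itself.\<close>
  have "coset_rep M A x = coset_rep M A \<zero>\<^bsub>M\<^esub> \<longleftrightarrow> x \<in> A" if "x \<in> carrier M" for x
    using that by (simp add: coset_rep_eq_iff M.minus_eq M.minus_equality[of "\<zero>\<^bsub>M\<^esub>" "\<zero>\<^bsub>M\<^esub>"])
  moreover have "A \<subseteq> carrier M" using A by (rule submodule_subset)
  ultimately show ?thesis by (auto simp: a_kernel_def' quotient_module_def)
qed

end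

end

section \<open>Length of submodules\<close>

context length_function
begin

text \<open>This is rank-nullity for \<open>f\<close> restricted to \<open>B\<close>, and the only
  place where additivity is invoked. Monotonicity, the modular law and the estimates for images
  follow from it.\<close>

lemma length_kernel_image:
  assumes "right_module R M" "right_module R Q" "f \<in> right_module_hom R M Q" "submodule B R M"
  shows "L (M\<lparr>carrier := B\<rparr>) = L (M\<lparr>carrier := B \<inter> a_kernel M Q f\<rparr>) + L (Q\<lparr>carrier := f ` B\<rparr>)"
proof (rule additive)
  interpret M: right_module R M by fact
  interpret Q: right_module R Q by fact
  have B: "B \<subseteq> carrier M" using assms(4) by (rule M.submodule_subset)
  show "right_module R (M\<lparr>carrier := B \<inter> a_kernel M Q f\<rparr>)"
    using assms by (intro M.right_module_restrict M.submodule_Int submodule_a_kernel)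
  show "right_module R (M\<lparr>carrier := B\<rparr>)" by (rule M.right_module_restrict) fact
  show "right_module R (Q\<lparr>carrier := f ` B\<rparr>)"
    using assms by (intro Q.right_module_restrict submodule_image)
  show "short_exact R (M\<lparr>carrier := B \<inter> a_kernel M Q f\<rparr>) id (M\<lparr>carrier := B\<rparr>) f (Q\<lparr>carrier := f ` B\<rparr>)"
    using assms(3) B
    by (auto simp: short_exact_def right_module_hom_def a_kernel_def' subset_iff)
qed

context
  fixes M :: "('a, 'b) module" assumes M: "right_module R M"
begin

interpretation M: right_module R M by (rule M)

abbreviation (input) len where "len A \<equiv> L (M\<lparr>carrier := A\<rparr>)"

lemma length_image_le:
  assumes "\<phi> \<in> right_module_hom R M M" "submodule B R M"
  shows "len (\<phi> ` B) \<le> len B"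
  using length_kernel_image[OF M M assms] by simp

text \<open>The projection modulo \<open>A\<close>, restricted to \<open>B\<close>, has kernel
  \<open>A\<close>, so \<open>len A\<close> is a summand of \<open>len B\<close>.\<close>

lemma length_mono:
  assumes "submodule A R M" "submodule B R M" "A \<subseteq> B"
  shows "len A \<le> len B"
  using length_kernel_image[OF M M.right_module_quotient M.coset_rep_hom, OF assms(1,1,2)] assms(3)
  by (simp add: M.a_kernel_coset_rep[OF assms(1)] Int_absorb1)

text \<open>\<open>A + B\<close> and \<open>B\<close> have the same image modulo \<open>A\<close>,
  with kernels \<open>A\<close> and \<open>A \<inter> B\<close>. Adding rather than subtracting the
  two length formulas keeps the identity valid for infinite lengths.\<close>

lemma length_modular:
  assumes A: "submodule A R M" and B: "submodule B R M"
  shows "len (A <+>\<^bsub>M\<^esub> B) + len (A \<inter> B) = len A + len B"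
proof -
  let ?Q = "quotient_module M A" and ?p = "coset_rep M A"
  interpret Q: right_module R ?Q by (rule M.right_module_quotient[OF A])
  note hom = M.coset_rep_hom[OF A]
  note len = length_kernel_image[OF M Q.right_module_axioms hom, unfolded M.a_kernel_coset_rep[OF A]]
  have sub: "A \<subseteq> carrier M" "B \<subseteq> carrier M" using A B by (simp_all add: M.submodule_subset)
  have p0: "?p x = \<zero>\<^bsub>?Q\<^esub>" if "x \<in> A" for x
    using that M.a_kernel_coset_rep[OF A] by (auto simp: a_kernel_def')
  have "?p ` (A <+>\<^bsub>M\<^esub> B) = ?p ` B"
  proof
    have "?p (a \<oplus>\<^bsub>M\<^esub> b) = ?p b" if "a \<in> A" "b \<in> B" for a b
    proof -
      have "?p (a \<oplus>\<^bsub>M\<^esub> b) = ?p a \<oplus>\<^bsub>?Q\<^esub> ?p b" "?p b \<in> carrier ?Q"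
        using that sub right_module_homD(1)[OF hom, of b] right_module_homD(2)[OF hom, of a b] by auto
      with that show ?thesis by (simp add: p0)
    qed
    then show "?p ` (A <+>\<^bsub>M\<^esub> B) \<subseteq> ?p ` B" by (auto simp: set_add_def')
    show "?p ` B \<subseteq> ?p ` (A <+>\<^bsub>M\<^esub> B)" using M.set_add_upper[OF A B] by auto
  qed
  then have "len (A <+>\<^bsub>M\<^esub> B) = len A + L (?Q\<lparr>carrier := ?p ` B\<rparr>)"
    using len[OF M.submodule_set_add[OF A B]] M.set_add_upper[OF A B] by (simp add: Int_absorb1)
  with len[OF B] show ?thesis by (simp add: ac_simps)
qed

lemma length_set_add_le:
  assumes "submodule A R M" "submodule B R M"
  shows "len (A <+>\<^bsub>M\<^esub> B) \<le> len A + len B"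
  by (simp flip: length_modular[OF assms])

text \<open>Enlarging a summand from \<open>P\<close> to \<open>N\<close> costs at most
  \<open>d\<close>. The modular law is applied to \<open>K + P\<close> and \<open>N\<close>: their
  sum is \<open>K + N\<close>, and their intersection contains \<open>P\<close>.\<close>

lemma length_set_add_right_le:
  assumes K: "submodule K R M" and N: "submodule N R M" and P: "submodule P R M" and "P \<subseteq> N"
    and fin: "len N < \<infinity>" and le: "len N \<le> len P + d"
  shows "len (K <+>\<^bsub>M\<^esub> N) \<le> len (K <+>\<^bsub>M\<^esub> P) + d"
proof -
  let ?KP = "K <+>\<^bsub>M\<^esub> P"
  have KP: "submodule ?KP R M" and I: "submodule (?KP \<inter> N) R M"
    using K N P by (auto intro: M.submodule_set_add M.submodule_Int)
  have sub: "K \<subseteq> carrier M" "N \<subseteq> carrier M" "P \<subseteq> carrier M"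
    using K N P by (simp_all add: M.submodule_subset)
  have "P <+>\<^bsub>M\<^esub> N = N"
    using M.set_add_absorb[OF N P \<open>P \<subseteq> N\<close>] M.set_add_comm sub by metis
  then have eq: "?KP <+>\<^bsub>M\<^esub> N = K <+>\<^bsub>M\<^esub> N"
    using M.set_add_assoc sub by metis
  have "len (?KP \<inter> N) + len (K <+>\<^bsub>M\<^esub> N) = len ?KP + len N"
    using length_modular[OF KP N] by (simp add: eq add.commute)
  also have "\<dots> \<le> len ?KP + (len P + d)" using le by (rule add_left_mono)
  also have "\<dots> \<le> len ?KP + (len (?KP \<inter> N) + d)"
    using length_mono[OF P I] M.set_add_upper[OF K P] \<open>P \<subseteq> N\<close>
    by (intro add_left_mono add_right_mono) auto
  finally have "len (?KP \<inter> N) + len (K <+>\<^bsub>M\<^esub> N) \<le> len (?KP \<inter> N) + (len ?KP + d)"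
    by (simp add: ac_simps)
  \<comment> \<open>Cancellation in \<open>ennreal\<close> requires a finite term; this one is
    bounded by \<open>len N\<close>.\<close>
  moreover have "len (?KP \<inter> N) \<noteq> \<infinity>"
    using length_mono[OF I N] fin by (auto simp: top_unique)
  ultimately show ?thesis by (simp add: ennreal_add_left_cancel_le)
qed

text \<open>The defect \<open>d\<close> cannot grow under \<open>\<phi>\<close>: by rank-nullity it
  splits between kernel and image, and the kernel part of \<open>P\<close> is no longer than that of
  \<open>N\<close>, which is finite and cancels.\<close>

lemma length_image_right_le:
  assumes hom: "\<phi> \<in> right_module_hom R M M"
    and N: "submodule N R M" and P: "submodule P R M" and "P \<subseteq> N"
    and fin: "len N < \<infinity>" and le: "len N \<le> len P + d"
  shows "len (\<phi> ` N) \<le> len (\<phi> ` P) + d"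
proof -
  let ?K = "a_kernel M M \<phi>"
  have K: "submodule ?K R M" by (rule submodule_a_kernel[OF M M hom])
  have "len (N \<inter> ?K) + len (\<phi> ` N) = len N"
    using length_kernel_image[OF M M hom N] by simp
  also have "\<dots> \<le> len (P \<inter> ?K) + len (\<phi> ` P) + d"
    using le length_kernel_image[OF M M hom P] by simp
  also have "len (P \<inter> ?K) \<le> len (N \<inter> ?K)"
    using N P K \<open>P \<subseteq> N\<close> by (intro length_mono M.submodule_Int) auto
  finally have "len (N \<inter> ?K) + len (\<phi> ` N) \<le> len (N \<inter> ?K) + (len (\<phi> ` P) + d)"
    by (simp add: ac_simps)
  moreover have "len (N \<inter> ?K) \<noteq> \<infinity>"
    using length_mono[OF M.submodule_Int[OF N K] N] fin by (auto simp: top_unique)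
  ultimately show ?thesis by (simp add: ennreal_add_left_cancel_le)
qed

lemma fin_gen_approx:
  assumes N: "submodule N R M" "len N < \<infinity>" and "e > (0 :: real)"
  obtains F where "F \<in> fin_gen_submodules R M" "submodule F R M" "F \<subseteq> N" "len N \<le> len F + ennreal e"
proof -
  have sup: "len N = (SUP F\<in>fin_gen_submodules R (M\<lparr>carrier := N\<rparr>). len F)"
    using upper_continuous[OF M.right_module_restrict[OF N(1)]] by simp
  have ne: "fin_gen_submodules R (M\<lparr>carrier := N\<rparr>) \<noteq> {}"
    by (auto simp: fin_gen_submodules_def)
  obtain F where F: "F \<in> fin_gen_submodules R (M\<lparr>carrier := N\<rparr>)" "len N < len F + ennreal e"
    using SUP_approx_ennreal[OF assms(3) ne sup] N(2) by (auto simp: less_top)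
  show thesis
    by (rule that[OF M.fin_gen_submodules_restrict[OF N(1) F(1)]]) (use F in simp)
qed

section \<open>Trajectories and entropy\<close>

context
  fixes \<phi> assumes hom: "\<phi> \<in> right_module_hom R M M"
begin

lemma submodule_funpow_image: "submodule N R M \<Longrightarrow> submodule ((\<phi> ^^ n) ` N) R M"
  using submodule_image[OF M M right_module_hom_funpow[OF hom]] .

lemma submodule_trajectory: "submodule N R M \<Longrightarrow> submodule (trajectory M \<phi> N n) R M"
  by (induction n) (auto intro: M.submodule_zero M.submodule_set_add submodule_funpow_image)

lemma length_zero: "len {\<zero>\<^bsub>M\<^esub>} = 0"
  using zero[OF M.right_module_restrict[OF M.submodule_zero]] by simp

lemma length_trajectory_finite:
  assumes "submodule N R M" "len N < \<infinity>"
  shows "len (trajectory M \<phi> N n) < \<infinity>"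
proof (induction n)
  case (Suc n)
  have "len (trajectory M \<phi> N (Suc n)) \<le> len (trajectory M \<phi> N n) + len ((\<phi> ^^ n) ` N)"
    using assms by (simp add: length_set_add_le submodule_trajectory submodule_funpow_image)
  also have "\<dots> \<le> len (trajectory M \<phi> N n) + len N"
    using assms by (intro add_left_mono length_image_le right_module_hom_funpow hom)
  also have "\<dots> < \<infinity>" using Suc assms by simp
  finally show ?case .
qed (simp add: length_zero)

text \<open>This splitting makes the length of the trajectory subadditive in \<open>n\<close>, since
  applying \<open>\<phi> ^^ m\<close> does not increase length.\<close>

lemma trajectory_add:
  assumes "submodule N R M"
  shows "trajectory M \<phi> N (m + n) = trajectory M \<phi> N m <+>\<^bsub>M\<^esub> (\<phi> ^^ m) ` trajectory M \<phi> N n"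
proof (induction n)
  case 0
  have "(\<phi> ^^ m) ` {\<zero>\<^bsub>M\<^esub>} = {\<zero>\<^bsub>M\<^esub>}"
    using right_module_hom_zero[OF M M right_module_hom_funpow[OF hom]] by simp
  moreover have "{\<zero>\<^bsub>M\<^esub>} \<subseteq> trajectory M \<phi> N m"
    using submodule_trajectory[OF assms, of m] by (simp add: M.submodule_iff)
  ultimately show ?case
    using M.set_add_absorb[OF submodule_trajectory[OF assms] M.submodule_zero] by simp
next
  case (Suc n)
  note sub = M.submodule_subset
  note T = submodule_trajectory[OF assms] and I = submodule_funpow_image
  have "(\<phi> ^^ m) ` trajectory M \<phi> N (Suc n)
      = (\<phi> ^^ m) ` trajectory M \<phi> N n <+>\<^bsub>M\<^esub> (\<phi> ^^ (m + n)) ` N"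
    using image_set_add[OF right_module_hom_funpow[OF hom] sub[OF T] sub[OF I[OF assms]]]
    by (simp add: funpow_add image_comp)
  then show ?case
    using Suc M.set_add_assoc[OF sub[OF T] sub[OF I[OF T]] sub[OF I[OF assms]]] by simp
qed

text \<open>\<open>entropy_at\<close> is defined by \<open>lim\<close>, which carries information
  only for a convergent sequence. Finite subadditive lengths and Fekete's lemma supply the
  convergence.\<close>

lemma entropy_at_LIMSEQ:
  assumes N: "submodule N R M" "len N < \<infinity>"
  shows "(\<lambda>n. len (trajectory M \<phi> N n) / of_nat n) \<longlonglongrightarrow> entropy_at L M \<phi> N"
  unfolding entropy_at_def convergent_LIMSEQ_iff[symmetric]
proof (rule fekete_ennreal)
  show "len (trajectory M \<phi> N n) < \<infinity>" for n by (rule length_trajectory_finite[OF N])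
  fix m n
  note T = submodule_trajectory[OF N(1)]
  have "len (trajectory M \<phi> N (m + n))
      \<le> len (trajectory M \<phi> N m) + len ((\<phi> ^^ m) ` trajectory M \<phi> N n)"
    unfolding trajectory_add[OF N(1)] by (intro length_set_add_le T submodule_funpow_image)
  also have "\<dots> \<le> len (trajectory M \<phi> N m) + len (trajectory M \<phi> N n)"
    by (intro add_left_mono length_image_le right_module_hom_funpow hom T)
  finally show "len (trajectory M \<phi> N (m + n)) \<le> \<dots>" .
qed

lemma trajectory_mono: "F \<subseteq> N \<Longrightarrow> trajectory M \<phi> F n \<subseteq> trajectory M \<phi> N n"
  by (induction n) (simp_all add: set_add_mono image_mono)

text \<open>Each of the \<open>n\<close> summands is replaced in turn, at a cost of at most
  \<open>d\<close>. In the induction step the newest summand is exchanged first, then the whole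
  earlier trajectory.\<close>

lemma length_trajectory_le:
  assumes N: "submodule N R M" and F: "submodule F R M" and "F \<subseteq> N"
    and fin: "len N < \<infinity>" and le: "len N \<le> len F + d"
  shows "len (trajectory M \<phi> N n) \<le> len (trajectory M \<phi> F n) + of_nat n * d"
proof (induction n)
  case (Suc n)
  let ?TN = "trajectory M \<phi> N n" and ?TF = "trajectory M \<phi> F n"
  let ?PN = "(\<phi> ^^ n) ` N" and ?PF = "(\<phi> ^^ n) ` F"
  note T = submodule_trajectory[OF N, of n] submodule_trajectory[OF F, of n]
  note P = submodule_funpow_image[OF N, of n] submodule_funpow_image[OF F, of n]
  have sub: "?TN \<subseteq> carrier M" "?TF \<subseteq> carrier M" "?PF \<subseteq> carrier M"
    using T P by (simp_all add: M.submodule_subset)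
  note funpow = right_module_hom_funpow[OF hom, of n]
  have fin': "len ?PN < \<infinity>" using length_image_le[OF funpow N] fin by (rule le_less_trans)
  have "len (?TN <+>\<^bsub>M\<^esub> ?PN) \<le> len (?TN <+>\<^bsub>M\<^esub> ?PF) + d"
    using \<open>F \<subseteq> N\<close> length_image_right_le[OF funpow N F \<open>F \<subseteq> N\<close> fin le]
    by (intro length_set_add_right_le T P fin') auto
  \<comment> \<open>The summands are swapped so that the earlier trajectory stands on the right; the
    induction hypothesis then serves as the estimate with defect
    \<open>of_nat n * d\<close>.\<close>
  also have "?TN <+>\<^bsub>M\<^esub> ?PF = ?PF <+>\<^bsub>M\<^esub> ?TN" using sub by (intro M.set_add_comm)
  also have "len (?PF <+>\<^bsub>M\<^esub> ?TN) \<le> len (?PF <+>\<^bsub>M\<^esub> ?TF) + of_nat n * d"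
    by (intro length_set_add_right_le T P trajectory_mono length_trajectory_finite N fin Suc \<open>F \<subseteq> N\<close>)
  also have "?PF <+>\<^bsub>M\<^esub> ?TF = ?TF <+>\<^bsub>M\<^esub> ?PF" using sub by (intro M.set_add_comm)
  finally show ?case by (simp add: algebra_simps)
qed simp

text \<open>The total error \<open>n * d\<close> over \<open>n\<close> steps becomes
  \<open>d\<close> after division by \<open>n\<close>, and the inequality survives the
  limit.\<close>

lemma entropy_at_le:
  assumes N: "submodule N R M" and F: "submodule F R M" and "F \<subseteq> N"
    and fin: "len N < \<infinity>" and le: "len N \<le> len F + d"
  shows "entropy_at L M \<phi> N \<le> entropy_at L M \<phi> F + d"
proof (rule tendsto_le[OF sequentially_bot])
  have finF: "len F < \<infinity>" using length_mono[OF F N \<open>F \<subseteq> N\<close>] fin by (rule le_less_trans)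
  show "(\<lambda>n. len (trajectory M \<phi> N n) / of_nat n) \<longlonglongrightarrow> entropy_at L M \<phi> N"
    by (rule entropy_at_LIMSEQ[OF N fin])
  show "(\<lambda>n. len (trajectory M \<phi> F n) / of_nat n + d) \<longlonglongrightarrow> entropy_at L M \<phi> F + d"
    by (intro tendsto_add tendsto_const entropy_at_LIMSEQ[OF F finF])
  have "len (trajectory M \<phi> N n) / of_nat n \<le> len (trajectory M \<phi> F n) / of_nat n + d"
    if "n > 0" for n
  proof -
    have "len (trajectory M \<phi> N n) / of_nat n
        \<le> (len (trajectory M \<phi> F n) + of_nat n * d) / of_nat n"
      by (intro divide_right_mono_ennreal length_trajectory_le assms)
    also have "\<dots> = len (trajectory M \<phi> F n) / of_nat n + d * of_nat n / of_nat n"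
      by (simp add: add_divide_distrib_ennreal mult.commute)
    also have "d * of_nat n / of_nat n = d"
      using that by (intro ennreal_mult_divide_eq) auto
    finally show ?thesis .
  qed
  then show "\<forall>\<^sub>F n in sequentially. len (trajectory M \<phi> N n) / of_nat n
      \<le> len (trajectory M \<phi> F n) / of_nat n + d"
    using eventually_gt_at_top[of 0] by (rule eventually_mono[rotated])
qed

end

end

end

section \<open>Comparison of the two suprema\<close>

theorem proposition4p2:
  fixes R :: "('a, 'r) ring_scheme"
    and L :: "('a, 'b) module \<Rightarrow> ennreal"
    and M :: "('a, 'b) module"
    and \<phi> :: "'b \<Rightarrow> 'b"
  assumes "ring R"
    and "length_function R L"
    and "right_module R M"
    and "\<phi> \<in> right_module_hom R M M"
  shows "entropy R L M \<phi> =
    (SUP F\<in>fin_gen_submodules R M \<inter> finite_length_submodules R L M. entropy_at L M \<phi> F)"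
    (is "_ = ?sup")
proof (rule antisym)
  interpret length_function R L by fact
  show "entropy R L M \<phi> \<le> ?sup"
    unfolding entropy_def
  \<comment> \<open>The approximating \<open>F\<close> depends on \<open>e\<close>, so its entropy
    is bounded by the supremum before \<open>e\<close> is made arbitrarily small.\<close>
  proof (rule SUP_least, rule ennreal_le_epsilon)
    fix N and e :: real
    assume "N \<in> finite_length_submodules R L M" and e: "0 < e"
    then have N: "submodule N R M" "L (M\<lparr>carrier := N\<rparr>) < \<infinity>"
      by (auto simp: finite_length_submodules_def)
    obtain F where F: "F \<in> fin_gen_submodules R M" "submodule F R M" "F \<subseteq> N"
      and le: "L (M\<lparr>carrier := N\<rparr>) \<le> L (M\<lparr>carrier := F\<rparr>) + ennreal e"
      using fin_gen_approx[OF assms(3) N e] .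
    have "L (M\<lparr>carrier := F\<rparr>) < \<infinity>"
      using length_mono[OF assms(3) F(2) N(1) F(3)] N(2) by (rule le_less_trans)
    with F have "F \<in> fin_gen_submodules R M \<inter> finite_length_submodules R L M"
      by (auto simp: finite_length_submodules_def)
    then have "entropy_at L M \<phi> F \<le> ?sup" by (rule SUP_upper)
    then show "entropy_at L M \<phi> N \<le> ?sup + ennreal e"
      using entropy_at_le[OF assms(3,4) N(1) F(2,3) N(2) le] add_right_mono order_trans by blast
  qed
  show "?sup \<le> entropy R L M \<phi>"
    unfolding entropy_def by (rule SUP_subset_mono) auto
qed

end
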